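(* Let $(\mathfrak g,[\cdot,\cdot],\alpha,B)$ be a quadratic multiplicative Hom-Lie algebra over $\mathbb K$. If the linear map $\alpha$ is an automorphism and the center satisfies $\mathcal Z(\mathfrak g)=\{0\}$, then $\alpha$ is an involution, i.e. $\alpha^2=\mathrm{id}$.
   Context: $\mathbb K$ is an algebraically closed field of characteristic $0$. A Hom-Lie algebra is a triple $(\mathfrak g,[\cdot,\cdot],\alpha)$ with $[\cdot,\cdot]$ a skew-symmetric bilinear bracket and $\alpha$ a linear map such that $[\alpha(x),[y,z]]+[\alpha(y),[z,x]]+[\alpha(z),[x,y]]=0$ for all $x,y,z$; it is multiplicative if $\alpha([x,y])=[\alpha(x),\alpha(y)]$. It is quadratic with form $B$ if $B$ is a symmetric nondegenerate bilinear form with $B([x,y],z)=B(x,[y,z])$ and $B(\alpha(x),y)=B(x,\alpha(y))$. The center is $\mathcal Z(\mathfrak g)=\{x:[x,y]=0\ \forall y\in\mathfrak g\}$. *)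

theory Defs
  imports Complex_Main "HOL-Computational_Algebra.Polynomial"
begin

definition bilinear_over ::
  "('k::field \<Rightarrow> 'a::ab_group_add \<Rightarrow> 'a) \<Rightarrow> ('k \<Rightarrow> 'b::ab_group_add \<Rightarrow> 'b) \<Rightarrow>
    ('k \<Rightarrow> 'c::ab_group_add \<Rightarrow> 'c) \<Rightarrow> ('a \<Rightarrow> 'b \<Rightarrow> 'c) \<Rightarrow> bool" where
  "bilinear_over s1 s2 s3 f \<longleftrightarrow>
    (\<forall>x. Vector_Spaces.linear s2 s3 (f x)) \<and>
    (\<forall>y. Vector_Spaces.linear s1 s3 (\<lambda>x. f x y))"

(* The underlying space is the whole type 'v with scalar multiplication scale; its dimension is
   arbitrary. *)
locale hom_lie_algebra = vector_space scale
  for scale :: "'k::{alg_closed_field, field_char_0} \<Rightarrow> 'v::ab_group_add \<Rightarrow> 'v" +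
  fixes bracket :: "'v \<Rightarrow> 'v \<Rightarrow> 'v"
    and \<alpha> :: "'v \<Rightarrow> 'v"
  assumes bracket_bilinear: "bilinear_over scale scale scale bracket"
    and alpha_linear: "Vector_Spaces.linear scale scale \<alpha>"
    and bracket_skew: "bracket x y = - bracket y x"
    and hom_jacobi:
      "bracket (\<alpha> x) (bracket y z) + bracket (\<alpha> y) (bracket z x)
        + bracket (\<alpha> z) (bracket x y) = 0"

locale multiplicative_hom_lie_algebra = hom_lie_algebra scale bracket \<alpha>
  for scale :: "'k::{alg_closed_field, field_char_0} \<Rightarrow> 'v::ab_group_add \<Rightarrow> 'v"
    and bracket \<alpha> +
  assumes alpha_bracket: "\<alpha> (bracket x y) = bracket (\<alpha> x) (\<alpha> y)"

(* Since B is symmetric, nondegeneracy in the first argument is nondegeneracy in both. *)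
locale quadratic_hom_lie_algebra = hom_lie_algebra scale bracket \<alpha>
  for scale :: "'k::{alg_closed_field, field_char_0} \<Rightarrow> 'v::ab_group_add \<Rightarrow> 'v"
    and bracket \<alpha> +
  fixes B :: "'v \<Rightarrow> 'v \<Rightarrow> 'k"
  assumes form_bilinear: "bilinear_over scale scale (*) B"
    and form_symmetric: "B x y = B y x"
    and form_nondegenerate: "(\<forall>y. B x y = 0) \<Longrightarrow> x = 0"
    and form_invariant: "B (bracket x y) z = B x (bracket y z)"
    and form_alpha: "B (\<alpha> x) y = B x (\<alpha> y)"

definition hom_lie_center :: "('v \<Rightarrow> 'v \<Rightarrow> 'v::zero) \<Rightarrow> 'v set" where
  "hom_lie_center bracket = {x. \<forall>y. bracket x y = 0}"

end

theory Submission
  imports Defs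
begin

text \<open>Moving \<open>\<alpha>\<close> across the form and the bracket gives
  \<open>B (\<alpha>[x,y]) z = B (\<alpha>x) [\<alpha>y,z] = B x [\<alpha>\<^sup>2y,\<alpha>z] = B (\<alpha>[x,\<alpha>\<^sup>2y]) z\<close>. By nondegeneracy and
  injectivity of \<open>\<alpha>\<close>, \<open>y - \<alpha>\<^sup>2y\<close> is central.\<close>

context hom_lie_algebra
begin

lemma bracket_diff_left: "bracket (x - y) z = bracket x z - bracket y z"
proof -
  have "Vector_Spaces.linear scale scale (\<lambda>x. bracket x z)"
    using bracket_bilinear by (simp add: bilinear_over_def)
  then show ?thesis
    by (rule module_hom.diff[OF Vector_Spaces.linear.axioms(3)])
qed

text \<open>The difference \<open>x - y\<close> is central, so a trivial center lets elements be
  compared through their brackets.\<close>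

lemma eq_if_bracket_eq:
  assumes "hom_lie_center bracket = {0}" and "\<And>z. bracket x z = bracket y z"
  shows "x = y"
proof -
  have "x - y \<in> hom_lie_center bracket"
    using assms(2) by (simp add: hom_lie_center_def bracket_diff_left)
  then show ?thesis
    using assms(1) by simp
qed

end

context quadratic_hom_lie_algebra
begin

lemma form_diff_left: "B (x - y) z = B x z - B y z"
proof -
  have "Vector_Spaces.linear scale (*) (\<lambda>x. B x z)"
    using form_bilinear by (simp add: bilinear_over_def)
  then show ?thesis
    by (rule module_hom.diff[OF Vector_Spaces.linear.axioms(3)])
qed

lemma eq_if_form_eq:
  assumes "\<And>z. B x z = B y z"
  shows "x = y"
  using form_nondegenerate[of "x - y"] assms by (simp add: form_diff_left)

lemma alpha_bracket_alpha_square: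
  assumes "multiplicative_hom_lie_algebra scale bracket \<alpha>"
  shows "\<alpha> (bracket x (\<alpha> (\<alpha> y))) = \<alpha> (bracket x y)"
proof (rule eq_if_form_eq)
  fix z
  interpret multiplicative_hom_lie_algebra scale bracket \<alpha> by fact
  have "B (\<alpha> (bracket x (\<alpha> (\<alpha> y)))) z = B x (bracket (\<alpha> (\<alpha> y)) (\<alpha> z))"
    by (simp only: form_alpha form_invariant)
  \<comment> \<open>The outer \<open>\<alpha>\<close>, now on \<open>z\<close>, pairs with one of
    the two on \<open>y\<close>: multiplicativity pulls them out of the bracket as a single
    \<open>\<alpha>\<close>, which self-adjointness moves onto \<open>x\<close>.\<close>
  also have "\<dots> = B (\<alpha> x) (bracket (\<alpha> y) z)"
    by (simp only: form_alpha alpha_bracket)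
  \<comment> \<open>Invariance brings \<open>\<alpha> x\<close> and \<open>\<alpha> y\<close> into
    one bracket, where multiplicativity merges the two maps.\<close>
  also have "\<dots> = B (\<alpha> (bracket x y)) z"
    by (simp only: form_invariant alpha_bracket)
  finally show "B (\<alpha> (bracket x (\<alpha> (\<alpha> y)))) z = B (\<alpha> (bracket x y)) z" .
qed

end

theorem proposition3p9:
  fixes scale :: "'k::{alg_closed_field, field_char_0} \<Rightarrow> 'v::ab_group_add \<Rightarrow> 'v"
    and bracket :: "'v \<Rightarrow> 'v \<Rightarrow> 'v"
    and \<alpha> :: "'v \<Rightarrow> 'v"
    and B :: "'v \<Rightarrow> 'v \<Rightarrow> 'k"
  assumes "quadratic_hom_lie_algebra scale bracket \<alpha> B"
    and "multiplicative_hom_lie_algebra scale bracket \<alpha>"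
    and "bij \<alpha>"
    and "hom_lie_center bracket = {0}"
  shows "\<alpha> \<circ> \<alpha> = id"
proof -
  interpret quadratic_hom_lie_algebra scale bracket \<alpha> B by fact
  have "\<alpha> (\<alpha> y) = y" for y
  proof (rule eq_if_bracket_eq[OF assms(4)])
    fix z
    have "bracket z (\<alpha> (\<alpha> y)) = bracket z y"
      by (rule injD[OF bij_is_inj[OF assms(3)] alpha_bracket_alpha_square[OF assms(2)]])
    \<comment> \<open>The center tests the left argument, whereas
      \<open>\<alpha> (\<alpha> y)\<close> was obtained in the right one; skew-symmetry exchanges
      the slots.\<close>
    then show "bracket (\<alpha> (\<alpha> y)) z = bracket y z"
      using bracket_skew[of _ z] by metis
  qed
  then show ?thesis
    by (simp add: fun_eq_iff)
qed

end
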